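(* Let $X$ and $Y$ be real linear topological spaces, and let "differentiable" have one fixed meaning among: bounded-differentiable, compact (Hadamard) differentiable, or (if it is defined, i.e. when $X$ and $Y$ are Banach spaces) Fréchet differentiable. If $X$ satisfies the blid-differentiable property, then every differentiable germ $f:X\to Y$ at $0$ has a global differentiable representative, i.e. there is a differentiable map $F:X\to Y$ defined on all of $X$ that coincides with a representative of the germ $f$ on some neighborhood of $0$.
   Context: Germs: two maps into $Y$ defined on neighborhoods of $0\in X$ are equivalent if they coincide on some neighborhood of $0$; a germ at $0$ is an equivalence class, and its members are its representatives. A germ is differentiable if it has a representative that is differentiable at every point of its (open) domain. A map $f$ is bounded-differentiable at $x$ if there is a continuous linear operator $A:X\to Y$ such that for every bounded subset $S\subset X$, for $h\in S$ and $t\in\mathbb{R}$, $f(x+th)-f(x)=tAh+r(th)$ with $r(th)/t\to0$ uniformly in $h\in S$ as $t\to0$. A map $f$ is compact (Hadamard) differentiable at $x$ if there is a continuous linear operator $A:X\to Y$ such that $f(x+t_nh_n)-f(x)=t_nAh+o(t_n)$ whenever $t_n\to0$ in $\mathbb{R}$ and $h_n\to h$ in $X$. A map is differentiable on a set if it is differentiable at each point of it. Blid-differentiable property of $X$: for every neighborhood $U\subset X$ of $0$ there is a differentiable map $H:X\to X$, defined on all of $X$, coinciding with the identity map on some neighborhood of $0$, such that $H(X)\subset U$. *)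

theory Defs
  imports "HOL-Analysis.Analysis"
begin

text \<open>Real linear topological spaces. No separation axiom is imposed.\<close>

class real_tvs = real_vector + topological_ab_group_add +
  assumes tendsto_scaleR_nhds:
    "((\<lambda>p. fst p *\<^sub>R snd p) \<longlongrightarrow> c *\<^sub>R x) (nhds c \<times>\<^sub>F nhds x)"

instance real_normed_vector \<subseteq> real_tvs
proof
  fix c :: real and x :: 'a
  show "((\<lambda>p. fst p *\<^sub>R snd p) \<longlongrightarrow> c *\<^sub>R x) (nhds c \<times>\<^sub>F nhds x)"
    by (intro tendsto_scaleR filterlim_fst filterlim_snd)
qed

definition tvs_bounded :: "'a::real_tvs set \<Rightarrow> bool" where
  "tvs_bounded S \<longleftrightarrow>
     (\<forall>V. open V \<and> 0 \<in> V \<longrightarrow> (\<exists>s>0. \<forall>t>s. S \<subseteq> (\<lambda>v. t *\<^sub>R v) ` V))"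

definition continuous_linear :: "('a::real_tvs \<Rightarrow> 'b::real_tvs) \<Rightarrow> bool" where
  "continuous_linear A \<longleftrightarrow> linear A \<and> continuous_on UNIV A"

text \<open>
  All notions of differentiability at a point depend only on the values of the map near that
  point. They are therefore stated for total functions, and are used for a partial map at the
  points of its open domain.
\<close>

definition bounded_differentiable :: "('a::real_tvs \<Rightarrow> 'b::real_tvs) \<Rightarrow> 'a \<Rightarrow> bool" where
  "bounded_differentiable f x \<longleftrightarrow>
     (\<exists>A. continuous_linear A \<and>
       (\<forall>S. tvs_bounded S \<longrightarrow>
         (\<forall>V. open V \<and> 0 \<in> V \<longrightarrow>
           (\<forall>\<^sub>F t in at (0::real). \<forall>h\<in>S.
              (1 / t) *\<^sub>R (f (x + t *\<^sub>R h) - f x - t *\<^sub>R A h) \<in> V))))"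

text \<open>
  If some \<open>t n = 0\<close>, the remainder at \<open>n\<close> vanishes and so does \<open>1 / t n\<close>,
  so such indices do not affect the limit.
\<close>

definition hadamard_differentiable :: "('a::real_tvs \<Rightarrow> 'b::real_tvs) \<Rightarrow> 'a \<Rightarrow> bool" where
  "hadamard_differentiable f x \<longleftrightarrow>
     (\<exists>A. continuous_linear A \<and>
       (\<forall>(t :: nat \<Rightarrow> real) h k. t \<longlonglongrightarrow> 0 \<and> h \<longlonglongrightarrow> k \<longrightarrow>
         (\<lambda>n. (1 / t n) *\<^sub>R (f (x + t n *\<^sub>R h n) - f x - t n *\<^sub>R A (h n))) \<longlonglongrightarrow> 0))"

abbreviation frechet_differentiable ::
    "('a::real_normed_vector \<Rightarrow> 'b::real_normed_vector) \<Rightarrow> 'a \<Rightarrow> bool" where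
  "frechet_differentiable f x \<equiv> f differentiable (at x)"

definition local_maps :: "('a::{topological_space, zero} \<rightharpoonup> 'b) set" where
  "local_maps = {f. 0 \<in> interior (dom f)}"

definition germ_rel :: "(('a::{topological_space, zero} \<rightharpoonup> 'b) \<times> ('a \<rightharpoonup> 'b)) set" where
  "germ_rel = {(f, g). f \<in> local_maps \<and> g \<in> local_maps \<and> (\<forall>\<^sub>F x in nhds 0. f x = g x)}"

lemma equiv_germ_rel: "equiv local_maps germ_rel"
proof (rule equivI)
  show "germ_rel \<subseteq> local_maps \<times> local_maps"
    by (auto simp: germ_rel_def)
  show "refl_on local_maps germ_rel"
    by (auto simp: germ_rel_def refl_on_def)
  show "sym germ_rel"
    by (auto simp: germ_rel_def sym_def eq_commute)
  show "trans germ_rel"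
    by (auto simp: germ_rel_def trans_def elim: eventually_elim2)
qed

definition germs :: "('a::{topological_space, zero} \<rightharpoonup> 'b) set set" where
  "germs = local_maps // germ_rel"

text \<open>
  In the following definitions \<open>D f x\<close> stands for differentiability of \<open>f\<close> at \<open>x\<close>,
  in whichever sense is being considered.
\<close>

definition differentiable_local_map ::
    "(('a::topological_space \<Rightarrow> 'b) \<Rightarrow> 'a \<Rightarrow> bool) \<Rightarrow> ('a \<rightharpoonup> 'b) \<Rightarrow> bool" where
  "differentiable_local_map D f \<longleftrightarrow> open (dom f) \<and> (\<forall>x\<in>dom f. D (\<lambda>y. the (f y)) x)"

definition differentiable_germ ::
    "(('a::topological_space \<Rightarrow> 'b) \<Rightarrow> 'a \<Rightarrow> bool) \<Rightarrow> ('a \<rightharpoonup> 'b) set \<Rightarrow> bool" where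
  "differentiable_germ D \<phi> \<longleftrightarrow> (\<exists>f\<in>\<phi>. differentiable_local_map D f)"

definition blid_property ::
    "(('a::{topological_space, zero} \<Rightarrow> 'a) \<Rightarrow> 'a \<Rightarrow> bool) \<Rightarrow> bool" where
  "blid_property D \<longleftrightarrow>
     (\<forall>U. 0 \<in> interior U \<longrightarrow>
       (\<exists>H. (\<forall>x. D H x) \<and> (\<forall>\<^sub>F x in nhds 0. H x = x) \<and> range H \<subseteq> U))"

end

theory Submission
  imports Defs
begin

text \<open>
  A blid map sends the whole space into a prescribed neighborhood of \<open>0\<close> and fixes the points
  close to \<open>0\<close>. Let \<open>f\<close> be a differentiable representative of the germ, with open domain,
  and let \<open>H\<close> be a blid map with values in that domain. Then \<open>f \<circ> H\<close> is defined everywhere and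
  agrees with \<open>f\<close> near \<open>0\<close>. It is differentiable as soon as the chain rule holds, so the whole
  statement rests on the chain rule for each notion of differentiability.

  For bounded differentiability the chain rule is delicate when the space is not normable. The
  difference quotient of \<open>H\<close> along a direction \<open>h\<close> is \<open>A h\<close> plus an error. The error tends to
  \<open>0\<close> uniformly for \<open>h\<close> in a bounded set \<open>S\<close>, but its values for all \<open>h \<in> S\<close> and all small \<open>t\<close>
  need not form a bounded set, so the condition on \<open>f\<close> cannot be applied to them directly. The
  remedy is to pass to sequences: bounded differentiability only has to be tested along sequences
  \<open>t n\<close> tending to \<open>0\<close> and bounded sequences \<open>h n\<close>. Along such sequences the errors form a null
  sequence, and null sequences are bounded.

  In this form bounded and Hadamard differentiability differ only in the class of admissible
  sequences of directions (bounded or convergent). One chain rule serves both: all it needs is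
  that the class is preserved by continuous linear maps followed by adding a null sequence.
\<close>

section \<open>Limits and bounded sequences in linear topological spaces\<close>

lemma tendsto_scaleR_tvs:
  fixes x :: "'i \<Rightarrow> 'a::real_tvs"
  assumes "(c \<longlongrightarrow> c0) F" and "(x \<longlongrightarrow> x0) F"
  shows "((\<lambda>i. c i *\<^sub>R x i) \<longlongrightarrow> c0 *\<^sub>R x0) F"
  using filterlim_compose[OF tendsto_scaleR_nhds filterlim_Pair[OF assms]] by simp

lemma continuous_linear_tendsto:
  assumes "continuous_linear A" and "(x \<longlongrightarrow> x0) F"
  shows "((\<lambda>i. A (x i)) \<longlongrightarrow> A x0) F"
  using assms unfolding continuous_linear_def
  by (auto intro: continuous_on_tendsto_compose[where s = UNIV])

lemma mem_scaleR_image_iff: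
  fixes x :: "'a::real_vector"
  assumes "t \<noteq> 0"
  shows "x \<in> (\<lambda>v. t *\<^sub>R v) ` V \<longleftrightarrow> (1 / t) *\<^sub>R x \<in> V"
proof
  assume "(1 / t) *\<^sub>R x \<in> V"
  then show "x \<in> (\<lambda>v. t *\<^sub>R v) ` V"
    using assms by (intro image_eqI[where x = "(1 / t) *\<^sub>R x"]) auto
qed (use assms in auto)

lemma tvs_bounded_iff_eventually:
  "tvs_bounded S \<longleftrightarrow>
     (\<forall>V. open V \<and> 0 \<in> V \<longrightarrow> (\<forall>\<^sub>F t in at_top. \<forall>x\<in>S. (1 / t) *\<^sub>R x \<in> V))"
proof -
  have "(\<exists>s>0. \<forall>t>s. S \<subseteq> (\<lambda>v. t *\<^sub>R v) ` V) \<longleftrightarrow>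
        (\<forall>\<^sub>F t in at_top. \<forall>x\<in>S. (1 / t) *\<^sub>R x \<in> V)" (is "?L \<longleftrightarrow> ?R") for V :: "'a set"
  proof
    assume ?L
    then obtain s where s: "s > 0" "\<And>t. t > s \<Longrightarrow> S \<subseteq> (\<lambda>v. t *\<^sub>R v) ` V" by blast
    show ?R using eventually_gt_at_top[of s]
    proof eventually_elim
      case (elim t)
      then show ?case using s(1) s(2)[OF elim] mem_scaleR_image_iff[of t _ V] by auto
    qed
  next
    assume ?R
    then obtain s where s: "\<And>t x. t \<ge> s \<Longrightarrow> x \<in> S \<Longrightarrow> (1 / t) *\<^sub>R x \<in> V"
      unfolding eventually_at_top_linorder by blast
    have "S \<subseteq> (\<lambda>v. t *\<^sub>R v) ` V" if "t > max s 1" for t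
      using that s[of t] mem_scaleR_image_iff[of t _ V] by auto
    then show ?L by (intro exI[of _ "max s 1"]) auto
  qed
  then show ?thesis unfolding tvs_bounded_def by simp
qed

lemma tvs_bounded_subset: "tvs_bounded S \<Longrightarrow> T \<subseteq> S \<Longrightarrow> tvs_bounded T"
  unfolding tvs_bounded_def by (meson subset_trans)

lemma tvs_bounded_continuous_linear_image:
  assumes A: "continuous_linear A" and S: "tvs_bounded S"
  shows "tvs_bounded (A ` S)"
  unfolding tvs_bounded_iff_eventually
proof (intro allI impI, elim conjE)
  fix V :: "'b set" assume "open V" "0 \<in> V"
  have "linear A" and "continuous_on UNIV A" using A by (auto simp: continuous_linear_def)
  then have "open (A -` V)" "0 \<in> A -` V"
    using \<open>open V\<close> \<open>0 \<in> V\<close> by (auto intro: open_vimage simp: linear_0)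
  then have "\<forall>\<^sub>F t in at_top. \<forall>x\<in>S. (1 / t) *\<^sub>R x \<in> A -` V"
    using S unfolding tvs_bounded_iff_eventually by blast
  then show "\<forall>\<^sub>F t in at_top. \<forall>y\<in>A ` S. (1 / t) *\<^sub>R y \<in> V"
    using \<open>linear A\<close> by (auto simp: linear_scale elim!: eventually_mono)
qed

lemma tvs_bounded_add:
  fixes u v :: "'i \<Rightarrow> 'a::real_tvs"
  assumes u: "tvs_bounded (range u)" and v: "tvs_bounded (range v)"
  shows "tvs_bounded (range (\<lambda>i. u i + v i))"
  unfolding tvs_bounded_iff_eventually
proof (intro allI impI, elim conjE)
  fix V :: "'a set" assume V: "open V" "0 \<in> V"
  have "((\<lambda>p. fst p + snd p) \<longlongrightarrow> 0 + (0::'a)) (nhds 0 \<times>\<^sub>F nhds 0)"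
    by (intro tendsto_add filterlim_fst filterlim_snd)
  then have "\<forall>\<^sub>F p in nhds 0 \<times>\<^sub>F nhds (0::'a). fst p + snd p \<in> V"
    using V by (auto dest: topological_tendstoD)
  then obtain P Q :: "'a \<Rightarrow> bool" where P: "eventually P (nhds 0)" and Q: "eventually Q (nhds 0)"
    and PQ: "\<And>x y. P x \<Longrightarrow> Q y \<Longrightarrow> x + y \<in> V"
    unfolding eventually_prod_filter by auto
  obtain V1 where V1: "open V1" "0 \<in> V1" "\<And>x. x \<in> V1 \<Longrightarrow> P x"
    using P unfolding eventually_nhds by blast
  obtain V2 where V2: "open V2" "0 \<in> V2" "\<And>x. x \<in> V2 \<Longrightarrow> Q x"
    using Q unfolding eventually_nhds by blast
  have "\<forall>\<^sub>F t in at_top. \<forall>x\<in>range u. (1 / t) *\<^sub>R x \<in> V1"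
    using u V1 unfolding tvs_bounded_iff_eventually by blast
  moreover have "\<forall>\<^sub>F t in at_top. \<forall>x\<in>range v. (1 / t) *\<^sub>R x \<in> V2"
    using v V2 unfolding tvs_bounded_iff_eventually by blast
  ultimately show "\<forall>\<^sub>F t in at_top. \<forall>x\<in>range (\<lambda>i. u i + v i). (1 / t) *\<^sub>R x \<in> V"
    by eventually_elim (use PQ V1(3) V2(3) in \<open>auto simp: scaleR_right_distrib\<close>)
qed

text \<open>
  Joint continuity of scalar multiplication at \<open>(0, 0)\<close> absorbs a tail of the sequence with one
  scaling factor, and each of the finitely many remaining terms is absorbed separately.
\<close>

lemma tvs_bounded_range_null_seq:
  fixes r :: "nat \<Rightarrow> 'a::real_tvs"
  assumes r: "r \<longlonglongrightarrow> 0"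
  shows "tvs_bounded (range r)"
  unfolding tvs_bounded_iff_eventually
proof (intro allI impI, elim conjE)
  fix V :: "'a set" assume V: "open V" "0 \<in> V"
  have inverse_null: "((\<lambda>t::real. 1 / t) \<longlongrightarrow> 0) at_top"
    using tendsto_inverse_0_at_top[OF filterlim_ident] by (simp add: inverse_eq_divide)
  have "\<forall>\<^sub>F p in nhds (0::real) \<times>\<^sub>F nhds (0::'a). fst p *\<^sub>R snd p \<in> V"
    using topological_tendstoD[OF tendsto_scaleR_nhds[of "0::real" "0::'a"] V(1)] V(2) by simp
  then obtain P :: "real \<Rightarrow> bool" and Q :: "'a \<Rightarrow> bool"
    where P: "eventually P (nhds 0)" and Q: "eventually Q (nhds 0)"
    and PQ: "\<And>c x. P c \<Longrightarrow> Q x \<Longrightarrow> c *\<^sub>R x \<in> V"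
    unfolding eventually_prod_filter by auto
  obtain N where N: "\<And>n. n \<ge> N \<Longrightarrow> Q (r n)"
    using eventually_compose_filterlim[OF Q r] unfolding eventually_sequentially by blast
  have "\<forall>\<^sub>F t in at_top. (1 / t) *\<^sub>R r n \<in> V" for n
    using topological_tendstoD[OF tendsto_scaleR_tvs[OF inverse_null tendsto_const[of "r n"]] V(1)]
      V(2) by simp
  then have "\<forall>\<^sub>F t in at_top. \<forall>n\<in>{..<N}. (1 / t) *\<^sub>R r n \<in> V"
    by (intro eventually_ball_finite) auto
  moreover have "\<forall>\<^sub>F t in at_top. P (1 / t)"
    using eventually_compose_filterlim[OF P inverse_null] .
  ultimately show "\<forall>\<^sub>F t in at_top. \<forall>x\<in>range r. (1 / t) *\<^sub>R x \<in> V"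
    by eventually_elim (use N PQ in \<open>auto simp: not_less[symmetric]\<close>)
qed

section \<open>Derivatives tested along sequences of directions\<close>

definition has_seq_derivative ::
    "((nat \<Rightarrow> 'a::real_tvs) \<Rightarrow> bool) \<Rightarrow> ('a \<Rightarrow> 'b::real_tvs) \<Rightarrow> 'a \<Rightarrow> ('a \<Rightarrow> 'b) \<Rightarrow> bool" where
  "has_seq_derivative admissible f x A \<longleftrightarrow>
     continuous_linear A \<and>
     (\<forall>(t :: nat \<Rightarrow> real) h. t \<longlonglongrightarrow> 0 \<and> admissible h \<longrightarrow>
        (\<lambda>n. (1 / t n) *\<^sub>R (f (x + t n *\<^sub>R h n) - f x - t n *\<^sub>R A (h n))) \<longlonglongrightarrow> 0)"

text \<open>
  With \<open>\<rho> n\<close> the normalized remainder of \<open>g\<close>, the point \<open>g (x + t n *\<^sub>R h n)\<close> is reached from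
  \<open>g x\<close> by the step \<open>t n\<close> in the direction \<open>A (h n) + \<rho> n\<close>. This direction is again admissible,
  so \<open>f\<close> can be expanded along it, and the remainder of the composition is that of \<open>f\<close> plus
  \<open>B (\<rho> n)\<close>.
\<close>

lemma has_seq_derivative_compose:
  assumes g: "has_seq_derivative P g x A" and f: "has_seq_derivative Q f (g x) B"
    and admissible: "\<And>h \<rho>. P h \<Longrightarrow> \<rho> \<longlonglongrightarrow> 0 \<Longrightarrow> Q (\<lambda>n. A (h n) + \<rho> n)"
  shows "has_seq_derivative P (\<lambda>y. f (g y)) x (\<lambda>h. B (A h))"
  unfolding has_seq_derivative_def
proof (intro conjI allI impI, goal_cases)
  case 1
  show ?case
    using g f unfolding has_seq_derivative_def continuous_linear_def
    by (auto simp: o_def dest: linear_compose intro: continuous_on_compose2[where t = UNIV])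
next
  case (2 t h)
  have "linear A" and B: "continuous_linear B" and "linear B"
    using g f by (auto simp: has_seq_derivative_def continuous_linear_def)
  define \<rho> where "\<rho> n = (1 / t n) *\<^sub>R (g (x + t n *\<^sub>R h n) - g x - t n *\<^sub>R A (h n))" for n
  define k where "k n = A (h n) + \<rho> n" for n
  have \<rho>: "\<rho> \<longlonglongrightarrow> 0"
    using g 2 unfolding has_seq_derivative_def \<rho>_def by blast
  have "Q k"
    unfolding k_def using admissible[OF _ \<rho>] 2 by blast
  then have lim_f: "(\<lambda>n. (1 / t n) *\<^sub>R (f (g x + t n *\<^sub>R k n) - f (g x) - t n *\<^sub>R B (k n))) \<longlonglongrightarrow> 0"
    using f 2 unfolding has_seq_derivative_def by blast
  have lim_B: "(\<lambda>n. B (\<rho> n)) \<longlonglongrightarrow> 0"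
    using continuous_linear_tendsto[OF B \<rho>] \<open>linear B\<close> by (simp add: linear_0)
  (* if t n = 0, then 1 / t n = 0, so both sides are g x *)
  have step: "g (x + t n *\<^sub>R h n) = g x + t n *\<^sub>R k n" for n
    by (cases "t n = 0") (simp_all add: k_def \<rho>_def scaleR_right_distrib)
  have "(1 / t n) *\<^sub>R (f (g (x + t n *\<^sub>R h n)) - f (g x) - t n *\<^sub>R B (A (h n))) =
        (1 / t n) *\<^sub>R (f (g x + t n *\<^sub>R k n) - f (g x) - t n *\<^sub>R B (k n)) + B (\<rho> n)" for n
  proof (cases "t n = 0")
    case True
    then show ?thesis using \<open>linear B\<close> by (simp add: \<rho>_def linear_0)
  next
    case False
    have "B (k n) = B (A (h n)) + B (\<rho> n)"
      unfolding k_def using \<open>linear B\<close> by (rule linear_add)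
    then show ?thesis
      using False unfolding step by (simp add: scaleR_right_distrib scaleR_right_diff_distrib)
  qed
  then show ?case
    using tendsto_add[OF lim_f lim_B] by simp
qed

text \<open>
  Uniformity over every bounded set is the same as convergence along every bounded sequence of
  directions: the filter at \<open>0\<close> on the real line is determined by sequences, and a failure of
  uniformity at \<open>t n\<close> is witnessed by a direction \<open>h n\<close> in the bounded set.
\<close>

lemma bounded_differentiable_iff_seq:
  "bounded_differentiable f x \<longleftrightarrow> (\<exists>A. has_seq_derivative (\<lambda>h. tvs_bounded (range h)) f x A)"
proof -
  have "(\<forall>S. tvs_bounded S \<longrightarrow> (\<forall>V. open V \<and> 0 \<in> V \<longrightarrow>
           (\<forall>\<^sub>F t in at (0::real). \<forall>h\<in>S. R t h \<in> V))) \<longleftrightarrow>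
        (\<forall>t h. t \<longlonglongrightarrow> 0 \<and> tvs_bounded (range h) \<longrightarrow> (\<lambda>n. R (t n) (h n)) \<longlonglongrightarrow> 0)"
    (is "?U \<longleftrightarrow> ?L") if R0: "\<And>h. R 0 h = 0" for R :: "real \<Rightarrow> 'a \<Rightarrow> 'b"
  proof
    assume U: ?U
    show ?L
    proof (intro allI impI topological_tendstoI)
      fix t :: "nat \<Rightarrow> real" and h :: "nat \<Rightarrow> 'a" and V :: "'b set"
      assume th: "t \<longlonglongrightarrow> 0 \<and> tvs_bounded (range h)" and V: "open V" "0 \<in> V"
      have "\<forall>\<^sub>F s in at 0. \<forall>d\<in>range h. R s d \<in> V"
        using U th V by blast
      (* sequences may hit 0, where the remainder vanishes, so a full neighborhood is needed *)
      then have "\<forall>\<^sub>F s in nhds 0. \<forall>d\<in>range h. R s d \<in> V"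
        unfolding eventually_at_filter
        by (rule eventually_mono) (use R0 V in force)
      then have "\<forall>\<^sub>F n in sequentially. \<forall>d\<in>range h. R (t n) d \<in> V"
        using th by (auto intro: eventually_compose_filterlim)
      then show "\<forall>\<^sub>F n in sequentially. R (t n) (h n) \<in> V"
        by (rule eventually_mono) auto
    qed
  next
    assume L: ?L
    show ?U
    proof (intro allI impI, elim conjE)
      fix S :: "'a set" and V :: "'b set"
      assume S: "tvs_bounded S" and V: "open V" "0 \<in> V"
      show "\<forall>\<^sub>F t in at 0. \<forall>h\<in>S. R t h \<in> V"
      proof (cases "S = {}")
        case False
        show ?thesis
        proof (rule sequentially_imp_eventually_at, intro allI impI, elim conjE)
          fix t :: "nat \<Rightarrow> real" assume t: "t \<longlonglongrightarrow> 0"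
          have "\<exists>d\<in>S. R (t n) d \<in> V \<longrightarrow> (\<forall>h\<in>S. R (t n) h \<in> V)" for n
            using False by blast
          then obtain h where h: "\<And>n. h n \<in> S"
            and worst: "\<And>n. R (t n) (h n) \<in> V \<Longrightarrow> \<forall>d\<in>S. R (t n) d \<in> V"
            by metis
          have "tvs_bounded (range h)"
            using S h by (auto intro: tvs_bounded_subset)
          then have "\<forall>\<^sub>F n in sequentially. R (t n) (h n) \<in> V"
            using L t V by (blast dest: topological_tendstoD)
          then show "\<forall>\<^sub>F n in sequentially. \<forall>d\<in>S. R (t n) d \<in> V"
            by (rule eventually_mono) (rule worst)
        qed
      qed simp
    qed
  qed
  from this[of "\<lambda>t h. (1 / t) *\<^sub>R (f (x + t *\<^sub>R h) - f x - t *\<^sub>R A h)" for A]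
  show ?thesis
    unfolding bounded_differentiable_def has_seq_derivative_def by simp
qed

lemma hadamard_differentiable_iff_seq:
  "hadamard_differentiable f x \<longleftrightarrow> (\<exists>A. has_seq_derivative (\<lambda>h. \<exists>k. h \<longlonglongrightarrow> k) f x A)"
  unfolding hadamard_differentiable_def has_seq_derivative_def by blast

lemma bounded_differentiable_compose:
  assumes "bounded_differentiable g x" and "bounded_differentiable f (g x)"
  shows "bounded_differentiable (\<lambda>y. f (g y)) x"
proof -
  obtain A B where A: "has_seq_derivative (\<lambda>h. tvs_bounded (range h)) g x A"
    and B: "has_seq_derivative (\<lambda>h. tvs_bounded (range h)) f (g x) B"
    using assms unfolding bounded_differentiable_iff_seq by blast
  have "tvs_bounded (range (\<lambda>n. A (h n) + \<rho> n))"
    if "tvs_bounded (range h)" "\<rho> \<longlonglongrightarrow> 0" for h :: "nat \<Rightarrow> 'a" and \<rho>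
  proof (rule tvs_bounded_add)
    show "tvs_bounded (range (\<lambda>n. A (h n)))"
      using tvs_bounded_continuous_linear_image[OF _ that(1)] A
      unfolding has_seq_derivative_def by (auto simp: image_image)
  qed (rule tvs_bounded_range_null_seq[OF that(2)])
  then have "has_seq_derivative (\<lambda>h. tvs_bounded (range h)) (\<lambda>y. f (g y)) x (\<lambda>h. B (A h))"
    by (rule has_seq_derivative_compose[OF A B])
  then show ?thesis
    unfolding bounded_differentiable_iff_seq by (intro exI[where x = "\<lambda>h. B (A h)"])
qed

lemma hadamard_differentiable_compose:
  assumes "hadamard_differentiable g x" and "hadamard_differentiable f (g x)"
  shows "hadamard_differentiable (\<lambda>y. f (g y)) x"
proof -
  obtain A B where A: "has_seq_derivative (\<lambda>h. \<exists>k. h \<longlonglongrightarrow> k) g x A"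
    and B: "has_seq_derivative (\<lambda>h. \<exists>k. h \<longlonglongrightarrow> k) f (g x) B"
    using assms unfolding hadamard_differentiable_iff_seq by blast
  have "\<exists>l. (\<lambda>n. A (h n) + \<rho> n) \<longlonglongrightarrow> l"
    if h: "\<exists>k. h \<longlonglongrightarrow> k" and \<rho>: "\<rho> \<longlonglongrightarrow> 0" for h :: "nat \<Rightarrow> 'a" and \<rho>
  proof -
    obtain k where k: "h \<longlonglongrightarrow> k" using h by blast
    have "continuous_linear A" using A by (simp add: has_seq_derivative_def)
    from tendsto_add[OF continuous_linear_tendsto[OF this k] \<rho>]
    show ?thesis by blast
  qed
  then have "has_seq_derivative (\<lambda>h. \<exists>k. h \<longlonglongrightarrow> k) (\<lambda>y. f (g y)) x (\<lambda>h. B (A h))"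
    by (rule has_seq_derivative_compose[OF A B])
  then show ?thesis
    unfolding hadamard_differentiable_iff_seq by (intro exI[where x = "\<lambda>h. B (A h)"])
qed

section \<open>Extending a germ by a blid map\<close>

lemma germ_has_global_representative:
  fixes \<phi> :: "('a::{topological_space, zero} \<rightharpoonup> 'b) set"
  assumes chain: "\<And>f H x. D H x \<Longrightarrow> E f (H x) \<Longrightarrow> E (\<lambda>y. f (H y)) x"
    and blid: "blid_property D" and \<phi>: "\<phi> \<in> germs" "differentiable_germ E \<phi>"
  shows "\<exists>F. (\<forall>x. E F x) \<and> (\<lambda>x. Some (F x)) \<in> \<phi>"
proof -
  obtain f where "f \<in> \<phi>" and f: "open (dom f)" "\<And>x. x \<in> dom f \<Longrightarrow> E (\<lambda>y. the (f y)) x"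
    using \<phi>(2) unfolding differentiable_germ_def differentiable_local_map_def by blast
  have "f \<in> local_maps"
    using \<phi>(1) \<open>f \<in> \<phi>\<close> in_quotient_imp_subset[OF equiv_germ_rel] unfolding germs_def by blast
  then have dom0: "0 \<in> interior (dom f)" by (simp add: local_maps_def)
  then obtain H where H: "\<And>x. D H x" "\<forall>\<^sub>F x in nhds 0. H x = x" "range H \<subseteq> dom f"
    using blid unfolding blid_property_def by blast
  define F where "F x = the (f (H x))" for x
  have "E F x" for x
    unfolding F_def using chain[OF H(1), of "\<lambda>y. the (f y)"] f(2) H(3) by blast
  moreover have "(\<lambda>x. Some (F x)) \<in> \<phi>"
  proof -
    have "\<forall>\<^sub>F x in nhds 0. x \<in> dom f"
      using dom0 f(1) by (auto simp: interior_open eventually_nhds)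
    with H(2) have "\<forall>\<^sub>F x in nhds 0. f x = Some (F x)"
      by eventually_elim (auto simp: F_def)
    then have "(f, \<lambda>x. Some (F x)) \<in> germ_rel"
      using \<open>f \<in> local_maps\<close> by (simp add: germ_rel_def local_maps_def dom_def)
    then show ?thesis
      using in_quotient_imp_closed[OF equiv_germ_rel _ \<open>f \<in> \<phi>\<close>] \<phi>(1) unfolding germs_def by blast
  qed
  ultimately show ?thesis by blast
qed

theorem proposition3p5:
  shows
   "(blid_property (bounded_differentiable :: ('x::real_tvs \<Rightarrow> 'x) \<Rightarrow> 'x \<Rightarrow> bool) \<longrightarrow>
      (\<forall>\<phi> \<in> (germs :: ('x \<rightharpoonup> 'y::real_tvs) set set).
         differentiable_germ bounded_differentiable \<phi> \<longrightarrow>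
         (\<exists>F. (\<forall>x. bounded_differentiable F x) \<and> (\<lambda>x. Some (F x)) \<in> \<phi>))) \<and>
    (blid_property (hadamard_differentiable :: ('x \<Rightarrow> 'x) \<Rightarrow> 'x \<Rightarrow> bool) \<longrightarrow>
      (\<forall>\<phi> \<in> (germs :: ('x \<rightharpoonup> 'y) set set).
         differentiable_germ hadamard_differentiable \<phi> \<longrightarrow>
         (\<exists>F. (\<forall>x. hadamard_differentiable F x) \<and> (\<lambda>x. Some (F x)) \<in> \<phi>))) \<and>
    (blid_property (frechet_differentiable :: ('a::banach \<Rightarrow> 'a) \<Rightarrow> 'a \<Rightarrow> bool) \<longrightarrow>
      (\<forall>\<phi> \<in> (germs :: ('a \<rightharpoonup> 'b::banach) set set).
         differentiable_germ frechet_differentiable \<phi> \<longrightarrow>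
         (\<exists>F. (\<forall>x. frechet_differentiable F x) \<and> (\<lambda>x. Some (F x)) \<in> \<phi>)))"
proof (intro conjI impI ballI)
  fix \<phi> :: "('x \<rightharpoonup> 'y) set"
  assume "blid_property (bounded_differentiable :: ('x \<Rightarrow> 'x) \<Rightarrow> 'x \<Rightarrow> bool)"
    "\<phi> \<in> germs" "differentiable_germ bounded_differentiable \<phi>"
  then show "\<exists>F. (\<forall>x. bounded_differentiable F x) \<and> (\<lambda>x. Some (F x)) \<in> \<phi>"
    by (rule germ_has_global_representative[rotated]) (rule bounded_differentiable_compose)
next
  fix \<phi> :: "('x \<rightharpoonup> 'y) set"
  assume "blid_property (hadamard_differentiable :: ('x \<Rightarrow> 'x) \<Rightarrow> 'x \<Rightarrow> bool)"
    "\<phi> \<in> germs" "differentiable_germ hadamard_differentiable \<phi>"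
  then show "\<exists>F. (\<forall>x. hadamard_differentiable F x) \<and> (\<lambda>x. Some (F x)) \<in> \<phi>"
    by (rule germ_has_global_representative[rotated]) (rule hadamard_differentiable_compose)
next
  fix \<phi> :: "('a \<rightharpoonup> 'b) set"
  assume "blid_property (frechet_differentiable :: ('a \<Rightarrow> 'a) \<Rightarrow> 'a \<Rightarrow> bool)"
    "\<phi> \<in> germs" "differentiable_germ frechet_differentiable \<phi>"
  then show "\<exists>F. (\<forall>x. frechet_differentiable F x) \<and> (\<lambda>x. Some (F x)) \<in> \<phi>"
    by (rule germ_has_global_representative[rotated]) (rule differentiable_chain_at[unfolded o_def])
qed

end
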